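(* Let $X$ be a real Banach space, let $\varphi: X\to[0,\infty)$ be a function, let $f: X\to(-\infty,\infty]$ have $\mathrm{dom}\,f\neq\emptyset$, and suppose that $(f\oplus\varphi)(x)>-\infty$ for all $x\in X$. Let $\bar x\in S_0$. Suppose that $\varphi$ is coercive on $X$ with constant $m>0$, and that $f$ is lower semicontinuous on $X$ and Lipschitz continuous on $D:=\mathrm{dom}\,f$ with constant $\ell$, where $0\le \ell<m$. Suppose further that $\varphi$ is subadditive and continuous at $0$ with $\varphi(0)=0$. Then $$\partial (f\oplus\varphi)(\bar x)\subset \partial f(\bar x)\cap[-\partial\varphi(0)].$$ Moreover, $$\partial (f\oplus\varphi)(\bar x)= \partial f(\bar x)\cap[-\partial\varphi(0)]$$ if, in addition, $\varphi$ is positively homogeneous and one of the following conditions holds: (i) $X$ is finite dimensional; (ii) $f$ is lower regular at $\bar x$.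
   Context: $X^*$ is the dual of $X$ with pairing $\langle\cdot,\cdot\rangle$. $\mathrm{dom}\,f:=\{x\in X: f(x)<\infty\}$. The infimal convolution is $(f\oplus\varphi)(x):=\inf\{f(w)+\varphi(w-x): w\in X\}$ (note the argument $w-x$); under the standing assumptions it is real-valued. $S_0:=\{x\in X: (f\oplus\varphi)(x)=f(x)\}$. $\varphi$ is coercive with constant $m>0$ if $m\|x\|\le\varphi(x)$ for all $x\in X$; subadditive if $\varphi(x+y)\le\varphi(x)+\varphi(y)$ for all $x,y$; positively homogeneous if $\varphi(tx)=t\varphi(x)$ for all $t>0$, $x\in X$. $f$ is Lipschitz continuous on $D$ with constant $\ell$ if $|f(x)-f(w)|\le\ell\|x-w\|$ for all $x,w\in D$. For $g:X\to(-\infty,\infty]$, $\varepsilon\ge0$ and $\bar x\in\mathrm{dom}\,g$, the $\varepsilon$-Fréchet subdifferential is $$\widehat\partial_\varepsilon g(\bar x):=\Big\{x^*\in X^*: \liminf_{x\to\bar x}\frac{g(x)-g(\bar x)-\langle x^*,x-\bar x\rangle}{\|x-\bar x\|}\ge-\varepsilon\Big\},$$ and $\widehat\partial g(\bar x):=\widehat\partial_0 g(\bar x)$. The limiting (Mordukhovich) subdifferential $\partial g(\bar x)$ is the set of all $x^*\in X^*$ for which there exist sequences $\varepsilon_k\downarrow0$, $x_k\to\bar x$ with $g(x_k)\to g(\bar x)$, and $x_k^*\in\widehat\partial_{\varepsilon_k}g(x_k)$ such that $x_k^*$ converges weak$^*$ to $x^*$. $g$ is lower regular at $\bar x\in\mathrm{dom}\,g$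 if $\widehat\partial g(\bar x)=\partial g(\bar x)$. For a set $A\subset X^*$, $-A:=\{-x^*:x^*\in A\}$. *)

theory Defs
  imports "HOL-Analysis.Analysis"
begin

text \<open>
  A function into the half-open interval from minus infinity (excluded) to plus infinity is an
  \<open>ereal\<close>-valued function that nowhere takes the value \<open>-\<infinity>\<close>; the dual of \<open>'a\<close> is
  \<^typ>\<open>'a::real_normed_vector \<Rightarrow>\<^sub>L real\<close>.
\<close>

definition effdom :: "('a \<Rightarrow> ereal) \<Rightarrow> 'a set" where
  "effdom g = {x. g x < \<infinity>}"

text \<open>The argument of \<open>\<phi>\<close> is \<open>w - x\<close>, not the more common \<open>x - w\<close>.\<close>

definition inf_conv ::
    "('a::real_normed_vector \<Rightarrow> ereal) \<Rightarrow> ('a \<Rightarrow> real) \<Rightarrow> 'a \<Rightarrow> ereal" where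
  "inf_conv f \<phi> x = (INF w. f w + ereal (\<phi> (w - x)))"

definition coincidence_set ::
    "('a::real_normed_vector \<Rightarrow> ereal) \<Rightarrow> ('a \<Rightarrow> real) \<Rightarrow> 'a set" where
  "coincidence_set f \<phi> = {x. inf_conv f \<phi> x = f x}"

definition lower_semicontinuous :: "('a::topological_space \<Rightarrow> ereal) \<Rightarrow> bool" where
  "lower_semicontinuous g \<longleftrightarrow> (\<forall>x. g x \<le> Liminf (at x) g)"

text \<open>The subdifferentials are empty at points outside the effective domain.\<close>

definition eps_frechet_subdiff ::
    "real \<Rightarrow> ('a::real_normed_vector \<Rightarrow> ereal) \<Rightarrow> 'a \<Rightarrow> ('a \<Rightarrow>\<^sub>L real) set" where
  "eps_frechet_subdiff \<epsilon> g a =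
     {p. a \<in> effdom g \<and>
         - ereal \<epsilon> \<le> Liminf (at a)
           (\<lambda>x. (g x - g a - ereal (blinfun_apply p (x - a))) / ereal (norm (x - a)))}"

definition frechet_subdiff ::
    "('a::real_normed_vector \<Rightarrow> ereal) \<Rightarrow> 'a \<Rightarrow> ('a \<Rightarrow>\<^sub>L real) set" where
  "frechet_subdiff g a = eps_frechet_subdiff 0 g a"

text \<open>
  The condition \<open>\<epsilon>\<^sub>k \<down> 0\<close> is read as nonincreasing convergence to 0 (so \<open>\<epsilon>\<^sub>k \<ge> 0\<close>). Weak* convergence
  is pointwise convergence of the functionals.
\<close>

definition limiting_subdiff ::
    "('a::real_normed_vector \<Rightarrow> ereal) \<Rightarrow> 'a \<Rightarrow> ('a \<Rightarrow>\<^sub>L real) set" where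
  "limiting_subdiff g a =
     {p. a \<in> effdom g \<and>
         (\<exists>(\<epsilon> :: nat \<Rightarrow> real) (x :: nat \<Rightarrow> 'a) (q :: nat \<Rightarrow> 'a \<Rightarrow>\<^sub>L real).
            decseq \<epsilon> \<and> \<epsilon> \<longlonglongrightarrow> 0 \<and>
            x \<longlonglongrightarrow> a \<and> (\<lambda>k. g (x k)) \<longlonglongrightarrow> g a \<and>
            (\<forall>k. q k \<in> eps_frechet_subdiff (\<epsilon> k) g (x k)) \<and>
            (\<forall>v. (\<lambda>k. blinfun_apply (q k) v) \<longlonglongrightarrow> blinfun_apply p v))}"

definition lower_regular :: "('a::real_normed_vector \<Rightarrow> ereal) \<Rightarrow> 'a \<Rightarrow> bool" where
  "lower_regular g a \<longleftrightarrow> a \<in> effdom g \<and> frechet_subdiff g a = limiting_subdiff g a"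

end

theory Submission
  imports Defs
begin

text \<open>
  Write \<open>h\<close> for the infimal convolution. Because \<open>\<phi>\<close> grows at rate at least \<open>m\<close> and \<open>f\<close> decreases at
  rate at most \<open>l < m\<close> on its domain, \<open>f w + \<phi> (w - x)\<close> exceeds \<open>f a\<close> by
  \<open>(m - l) * norm (w - a) - m * norm (x - a)\<close> for every \<open>a\<close> in the domain (lemma \<open>growth\<close>). Hence \<open>h = f\<close>
  on the domain of \<open>f\<close>, and near minimizers \<open>w\<close> at a point \<open>x\<close> close to \<open>a\<close> are themselves close
  to \<open>a\<close>. Both halves of the theorem rest on this estimate.

  For the inclusion, take an \<open>\<epsilon>\<close>-subgradient \<open>q\<close> of \<open>h\<close> at \<open>x\<close> and a near minimizer \<open>w\<close>. Moving \<open>w\<close>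
  along with \<open>x\<close> leaves the value of \<open>\<phi>\<close> unchanged, so \<open>q\<close> satisfies the subgradient inequality for
  \<open>f\<close> at \<open>w\<close> up to a small additive error; moving \<open>x\<close> with \<open>w\<close> fixed gives the same for \<open>- q\<close> and
  \<open>\<phi>\<close> at \<open>w - x\<close>. The infimum need not be attained, so the additive error is genuine. Ekeland's
  variational principle trades it for a small displacement of the base point and a small increase
  of \<open>\<epsilon>\<close> (\<open>almost_subgradient_nearby\<close>, \<open>inf_conv_subgradient_splits\<close>). As \<open>x\<close> tends to the
  coincidence point the two base points tend to it and to \<open>0\<close>, so the weak* limit \<open>p\<close> is a limiting
  subgradient of \<open>f\<close> and \<open>- p\<close> is one of \<open>\<phi>\<close>.

  For the reverse inclusion, a limiting subgradient \<open>- p\<close> of a sublinear \<open>\<phi>\<close> at \<open>0\<close> is a linear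
  minorant of \<open>\<phi>\<close>. If \<open>q\<close> is an \<open>\<epsilon>\<close>-subgradient of \<open>f\<close> at \<open>a\<close> and \<open>- q \<le> \<phi>\<close> up to
  \<open>\<kappa> * norm\<close>, adding the two inequalities gives one for \<open>h\<close> at \<open>a\<close>, with an error controlled by \<open>\<epsilon>\<close>
  and \<open>\<kappa>\<close>: only those \<open>w\<close> matter whose distance from \<open>a\<close> is at most a constant times
  \<open>norm (x - a)\<close> (\<open>eps_frechet_subdiff_inf_convI\<close>). When \<open>p\<close> is a Frechet subgradient of \<open>f\<close> one takes
  \<open>q = p\<close>; in finite dimension the approximating \<open>q\<close> converge to \<open>p\<close> in norm, so \<open>\<kappa>\<close> tends to \<open>0\<close>.
\<close>

section \<open>Epsilon-Frechet subgradients as local inequalities\<close>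

text \<open>
  Since \<open>g\<close> may take the value \<open>\<infinity>\<close>, the quotient in the definition is awkward to compute with. The
  form without division is a local cone inequality, the same for finite and infinite \<open>g x\<close> and valid
  at \<open>x = a\<close> as well.
\<close>

lemma eps_frechet_subdiff_iff:
  assumes ga: "g a \<noteq> -\<infinity>"
  shows "p \<in> eps_frechet_subdiff \<epsilon> g a \<longleftrightarrow>
     a \<in> effdom g \<and>
     (\<forall>\<delta>>0. \<exists>r>0. \<forall>x. norm (x - a) < r \<longrightarrow>
        ereal (real_of_ereal (g a) + blinfun_apply p (x - a) - (\<epsilon> + \<delta>) * norm (x - a)) \<le> g x)"
    (is "_ \<longleftrightarrow> _ \<and> ?R")
proof (cases "a \<in> effdom g")
  case True
  define c where "c = real_of_ereal (g a)"
  have gac: "g a = ereal c"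
    using True ga by (cases "g a") (auto simp: c_def effdom_def)
  \<comment> \<open>For a finite slope, comparing the quotient is the same as comparing \<open>g\<close> with a cone.\<close>
  have quot: "ereal y < (g x - g a - ereal (blinfun_apply p (x - a))) / ereal (norm (x - a)) \<longleftrightarrow>
     ereal (c + blinfun_apply p (x - a) + y * norm (x - a)) < g x" if "x \<noteq> a" for x y
  proof -
    have n: "0 < norm (x - a)" using that by simp
    show ?thesis
      using n by (cases "g x") (auto simp: gac pos_less_divide_eq algebra_simps)
  qed
  have "- ereal \<epsilon> \<le> Liminf (at a)
           (\<lambda>x. (g x - g a - ereal (blinfun_apply p (x - a))) / ereal (norm (x - a))) \<longleftrightarrow> ?R"
    (is "?L \<longleftrightarrow> _")
  proof
    assume L: ?L
    show ?R
    proof (intro allI impI)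
      fix \<delta> :: real assume "0 < \<delta>"
      then have "ereal (- (\<epsilon> + \<delta>)) < - ereal \<epsilon>" by simp
      with L have "eventually (\<lambda>x. ereal (- (\<epsilon> + \<delta>)) <
          (g x - g a - ereal (blinfun_apply p (x - a))) / ereal (norm (x - a))) (at a)"
        unfolding le_Liminf_iff by blast
      then obtain r where "r > 0" and r: "\<And>x. x \<noteq> a \<Longrightarrow> dist x a < r \<Longrightarrow> ereal (- (\<epsilon> + \<delta>)) <
          (g x - g a - ereal (blinfun_apply p (x - a))) / ereal (norm (x - a))"
        unfolding eventually_at by auto
      have "ereal (c + blinfun_apply p (x - a) - (\<epsilon> + \<delta>) * norm (x - a)) \<le> g x"
        if "norm (x - a) < r" for x
      proof (cases "x = a")
        case False
        then show ?thesis
          using quot[OF False, of "- (\<epsilon> + \<delta>)"] r[OF False] that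
          by (simp add: dist_norm order.strict_implies_order algebra_simps)
      qed (simp add: gac)
      then show "\<exists>r>0. \<forall>x. norm (x - a) < r \<longrightarrow>
          ereal (real_of_ereal (g a) + blinfun_apply p (x - a) - (\<epsilon> + \<delta>) * norm (x - a)) \<le> g x"
        using \<open>r > 0\<close> unfolding c_def by blast
    qed
  next
    assume R: ?R
    show ?L
      unfolding le_Liminf_iff
    proof (intro allI impI)
      fix y assume "y < - ereal \<epsilon>"
      then obtain t where t: "y < ereal t" "ereal t < - ereal \<epsilon>"
        using ereal_dense2 by blast
      then have "0 < (- \<epsilon> - t) / 2" by simp
      then obtain r where "r > 0" and r: "\<And>x. norm (x - a) < r \<Longrightarrow>
          ereal (c + blinfun_apply p (x - a) - (\<epsilon> + (- \<epsilon> - t) / 2) * norm (x - a)) \<le> g x"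
        using R unfolding c_def by blast
      have "y < (g x - g a - ereal (blinfun_apply p (x - a))) / ereal (norm (x - a))"
        if "x \<noteq> a" "norm (x - a) < r" for x
      proof -
        have "t * norm (x - a) < - (\<epsilon> + (- \<epsilon> - t) / 2) * norm (x - a)"
          using that t by (intro mult_strict_right_mono) (auto simp: field_simps)
        then have "ereal (c + blinfun_apply p (x - a) + t * norm (x - a)) < g x"
          by (intro less_le_trans[OF _ r[OF that(2)]])
            (simp only: less_ereal.simps mult_minus_left)
        then show ?thesis
          using quot[OF that(1), of t] t(1) by (meson order.strict_trans)
      qed
      then show "eventually (\<lambda>x. y < (g x - g a - ereal (blinfun_apply p (x - a))) / ereal (norm (x - a))) (at a)"
        unfolding eventually_at using \<open>r > 0\<close> by (auto simp: dist_norm)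
    qed
  qed
  then show ?thesis
    using True by (simp add: eps_frechet_subdiff_def)
qed (simp add: eps_frechet_subdiff_def)

lemma eps_frechet_subdiff_mono:
  "\<epsilon> \<le> \<epsilon>' \<Longrightarrow> eps_frechet_subdiff \<epsilon> g a \<subseteq> eps_frechet_subdiff \<epsilon>' g a"
  unfolding eps_frechet_subdiff_def
  by (auto elim!: order_trans[rotated])

text \<open>
  Enlarging \<open>\<epsilon>\<close> enlarges the subdifferential, so a null sequence may be replaced by its
  nonincreasing majorant, the supremum over each tail.
\<close>

lemma limiting_subdiffI:
  fixes \<epsilon> :: "nat \<Rightarrow> real"
  assumes "a \<in> effdom g" "\<epsilon> \<longlonglongrightarrow> 0" "x \<longlonglongrightarrow> a" "(\<lambda>k. g (x k)) \<longlonglongrightarrow> g a"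
    and sub: "\<And>k. q k \<in> eps_frechet_subdiff (\<epsilon> k) g (x k)"
    and "\<And>v. (\<lambda>k. blinfun_apply (q k) v) \<longlonglongrightarrow> blinfun_apply p v"
  shows "p \<in> limiting_subdiff g a"
proof -
  have bdd: "bdd_above (\<epsilon> ` {k..})" for k
    using convergent_imp_Bseq[OF convergentI[OF assms(2)]]
    by (metis Bseq_bdd_above bdd_above_mono image_mono subset_UNIV)
  define e where "e k = (SUP j\<in>{k..}. \<epsilon> j)" for k
  have le: "\<epsilon> k \<le> e k" for k
    unfolding e_def by (rule cSUP_upper[OF _ bdd]) simp
  have dec: "decseq e"
    unfolding decseq_def e_def by (auto intro!: cSUP_subset_mono bdd)
  have "e \<longlonglongrightarrow> 0"
  proof (rule LIMSEQ_I)
    fix r :: real assume "0 < r"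
    then obtain N where N: "\<And>n. n \<ge> N \<Longrightarrow> norm (\<epsilon> n - 0) < r / 2"
      using LIMSEQ_D[OF assms(2), of "r/2"] by auto
    have "norm (e n - 0) < r" if "n \<ge> N" for n
    proof -
      have "e n \<le> r / 2"
        unfolding e_def
      proof (rule cSUP_least)
        fix j assume "j \<in> {n..}"
        then show "\<epsilon> j \<le> r / 2" using N[of j] that by auto
      qed simp
      moreover have "- r / 2 \<le> e n"
        using N[OF that] le[of n] by auto
      ultimately show ?thesis using \<open>0 < r\<close> by auto
    qed
    then show "\<exists>no. \<forall>n\<ge>no. norm (e n - 0) < r" by blast
  qed
  moreover have "q k \<in> eps_frechet_subdiff (e k) g (x k)" for k
    using sub eps_frechet_subdiff_mono[OF le] by blast
  ultimately show ?thesis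
    unfolding limiting_subdiff_def using assms dec by blast
qed

section \<open>The variational principle and exact subgradients\<close>

text \<open>
  The sets \<open>T u\<close> of points lying below \<open>u\<close> by at least \<open>\<eta>\<close> times the distance define a partial
  order on \<open>S\<close>, and the conclusion asks for a minimal element below \<open>a\<close>. A sequence descending
  almost as far as possible at each step gives nested closed sets of vanishing diameter, whose
  common point is minimal.
\<close>

lemma ekeland_variational_principle:
  fixes F :: "'a::complete_space \<Rightarrow> real"
  assumes S: "closed S" "continuous_on S F" and bdd: "\<And>x. x \<in> S \<Longrightarrow> B \<le> F x"
    and a: "a \<in> S" and \<eta>: "\<eta> > 0"
  obtains y where "y \<in> S" "F y + \<eta> * dist y a \<le> F a"
    "\<And>x. x \<in> S \<Longrightarrow> F y \<le> F x + \<eta> * dist x y"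
proof -
  define T where "T u = {x \<in> S. F x + \<eta> * dist x u \<le> F u}" for u
  have T_self: "u \<in> T u" if "u \<in> S" for u
    using that by (simp add: T_def)
  have T_sub: "T v \<subseteq> T u" if "v \<in> T u" for u v
  proof
    fix x assume x: "x \<in> T v"
    have "\<eta> * dist x u \<le> \<eta> * (dist x v + dist v u)"
      using \<eta> by (intro mult_left_mono dist_triangle) auto
    then show "x \<in> T u" using x that by (auto simp: T_def algebra_simps)
  qed
  have "closed (T u)" for u
  proof -
    have "continuous_on S (\<lambda>x. F x + \<eta> * dist x u)"
      by (intro continuous_intros S)
    then have "closed (S \<inter> (\<lambda>x. F x + \<eta> * dist x u) -` {..F u})"
      by (intro continuous_closed_preimage S) auto
    also have "S \<inter> (\<lambda>x. F x + \<eta> * dist x u) -` {..F u} = T u" by (auto simp: T_def)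
    finally show ?thesis .
  qed
  note T_closed = this
  \<comment> \<open>Each step almost minimizes \<open>F\<close> on the current set, so the next set has small diameter.\<close>
  have step: "\<exists>v. v \<in> T u \<and> (\<forall>x\<in>T u. F v \<le> F x + 1 / 2 ^ n)" if "u \<in> S" for u and n :: nat
  proof -
    have ne: "F ` T u \<noteq> {}" using T_self[OF that] by auto
    have "bdd_below (F ` T u)" using bdd by (auto simp: T_def bdd_below_def)
    moreover have "Inf (F ` T u) < Inf (F ` T u) + 1 / 2 ^ n" by simp
    ultimately obtain v where "v \<in> T u" "F v < Inf (F ` T u) + 1 / 2 ^ n"
      using cInf_lessD[OF ne] by blast
    moreover have "Inf (F ` T u) \<le> F x" if "x \<in> T u" for x
      using that \<open>bdd_below (F ` T u)\<close> by (intro cInf_lower) auto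
    ultimately show ?thesis by fastforce
  qed
  have "\<exists>u. \<forall>n. (u n \<in> S \<and> (n = 0 \<longrightarrow> u n = a)) \<and>
      (u (Suc n) \<in> T (u n) \<and> (\<forall>x\<in>T (u n). F (u (Suc n)) \<le> F x + 1 / 2 ^ n))"
  proof (rule dependent_nat_choice)
    show "\<exists>u. u \<in> S \<and> (0 = (0::nat) \<longrightarrow> u = a)" using a by blast
    fix u and n :: nat assume "u \<in> S \<and> (n = 0 \<longrightarrow> u = a)"
    then obtain v where "v \<in> T u" "\<forall>x\<in>T u. F v \<le> F x + 1 / 2 ^ n"
      using step by blast
    moreover from this have "v \<in> S" by (simp add: T_def)
    ultimately show "\<exists>v. (v \<in> S \<and> (Suc n = 0 \<longrightarrow> v = a)) \<and>
        (v \<in> T u \<and> (\<forall>x\<in>T u. F v \<le> F x + 1 / 2 ^ n))" by blast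
  qed
  then obtain u where u0: "u 0 = a" and uS: "\<And>n. u n \<in> S" and uT: "\<And>n. u (Suc n) \<in> T (u n)"
    and umin: "\<And>n x. x \<in> T (u n) \<Longrightarrow> F (u (Suc n)) \<le> F x + 1 / 2 ^ n"
    by blast
  have small: "dist x (u (Suc n)) \<le> 1 / 2 ^ n / \<eta>" if "x \<in> T (u (Suc n))" for x n
  proof -
    have "F (u (Suc n)) \<le> F x + 1 / 2 ^ n"
      using umin T_sub[OF uT] that by blast
    then have "\<eta> * dist x (u (Suc n)) \<le> 1 / 2 ^ n" using that by (auto simp: T_def)
    then show ?thesis using \<eta> by (simp add: field_simps)
  qed
  obtain y where y: "\<And>n. y \<in> T (u n)"
  proof (rule decreasing_closed_nest[of "\<lambda>n. T (u n)"])
    show "T (u n) \<subseteq> T (u k)" if "k \<le> n" for k n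
      using lift_Suc_antimono_le[of "\<lambda>n. T (u n)", OF T_sub[OF uT] that] .
  next
    fix e :: real assume e: "0 < e"
    obtain n where "(1/2) ^ n < e * \<eta> / 2"
      using real_arch_pow_inv[of "e * \<eta> / 2" "1/2"] e \<eta> by auto
    then have n: "1 / 2 ^ n / \<eta> < e / 2" using \<eta> by (simp add: field_simps)
    have "dist x z < e" if "x \<in> T (u (Suc n))" "z \<in> T (u (Suc n))" for x z
      using small[OF that(1)] small[OF that(2)] n dist_triangle2[of x z "u (Suc n)"] by linarith
    then show "\<exists>n. \<forall>x\<in>T (u n). \<forall>z\<in>T (u n). dist x z < e" by blast
  next
    show "closed (T (u n))" "T (u n) \<noteq> {}" for n using T_closed T_self[OF uS] by blast+
  qed blast
  show ?thesis
  proof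
    show "y \<in> S" "F y + \<eta> * dist y a \<le> F a" using y[of 0] by (auto simp: T_def u0)
    fix x assume "x \<in> S"
    show "F y \<le> F x + \<eta> * dist x y"
    proof (rule ccontr)
      assume "\<not> ?thesis"
      then have "x \<in> T y" and "x \<noteq> y" using \<open>x \<in> S\<close> by (auto simp: T_def)
      then have "x \<in> T (u n)" for n using T_sub[OF y] by blast
      then have "dist x y \<le> 2 * (1 / 2 ^ n / \<eta>)" for n
        using small[OF \<open>\<And>n. x \<in> T (u n)\<close>, of n] small[OF y, of n]
          dist_triangle2[of x y "u (Suc n)"] by linarith
      moreover obtain n where "(1/2) ^ n < dist x y * \<eta> / 2"
        using real_arch_pow_inv[of "dist x y * \<eta> / 2" "1/2"] \<open>x \<noteq> y\<close> \<eta> by auto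
      then have "2 * (1 / 2 ^ n / \<eta>) < dist x y" using \<eta> by (simp add: field_simps)
      ultimately show False by (meson not_le)
    qed
  qed
qed

text \<open>
  The tilted function \<open>g - q + \<epsilon> * norm (_ - a)\<close> is within \<open>\<eta>\<^sup>2\<close> of its minimum over the ball at \<open>a\<close>.
  Ekeland's principle with slope \<open>\<eta>\<close> therefore moves \<open>a\<close> by at most \<open>\<eta>\<close>, and minimality at the new
  point is a subgradient inequality. The condition \<open>\<eta> < r\<close> keeps that point inside the ball, so the
  inequality holds in a full neighbourhood of it.
\<close>

lemma almost_subgradient_nearby:
  fixes g :: "'a::banach \<Rightarrow> ereal"
  assumes g: "\<And>x. g x \<noteq> -\<infinity>" "closed (effdom g)"
      "continuous_on (effdom g) (\<lambda>x. real_of_ereal (g x))"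
    and a: "a \<in> effdom g" and "0 < \<eta>" "\<eta> < r" "0 \<le> \<epsilon>"
    and almost: "\<And>x. norm (x - a) \<le> r \<Longrightarrow>
      ereal (real_of_ereal (g a) + blinfun_apply q (x - a) - \<epsilon> * norm (x - a) - \<eta>\<^sup>2) \<le> g x"
  obtains y where "y \<in> effdom g" "dist y a \<le> \<eta>" "q \<in> eps_frechet_subdiff (\<epsilon> + \<eta>) g y"
proof -
  define G where "G x = real_of_ereal (g x)" for x
  have gG: "g x = ereal (G x)" if "x \<in> effdom g" for x
    using that g(1)[of x] by (cases "g x") (auto simp: G_def effdom_def)
  define F where "F x = G x - blinfun_apply q (x - a) + \<epsilon> * norm (x - a)" for x
  define S where "S = effdom g \<inter> cball a r"
  have F_ge: "G a - \<eta>\<^sup>2 \<le> F x" if "x \<in> S" for x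
  proof -
    have "norm (x - a) \<le> r" using that by (auto simp: S_def dist_norm norm_minus_commute)
    from almost[OF this] show ?thesis
      using gG[of x] gG[OF a] that by (auto simp: S_def F_def)
  qed
  have "closed S" unfolding S_def by (intro closed_Int g closed_cball)
  moreover have "continuous_on S F"
    unfolding F_def S_def G_def
    by (intro continuous_intros continuous_on_subset[OF g(3)]) auto
  moreover have "a \<in> S" using a \<open>0 < \<eta>\<close> \<open>\<eta> < r\<close> by (simp add: S_def)
  ultimately obtain y where y: "y \<in> S" "F y + \<eta> * dist y a \<le> F a"
    and ymin: "\<And>x. x \<in> S \<Longrightarrow> F y \<le> F x + \<eta> * dist x y"
    using ekeland_variational_principle[of S F "G a - \<eta>\<^sup>2" a \<eta>] F_ge \<open>0 < \<eta>\<close> by metis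
  have "\<eta> * dist y a \<le> \<eta> * \<eta>"
    using y F_ge[OF y(1)] by (simp add: F_def power2_eq_square)
  then have dy: "dist y a \<le> \<eta>" using \<open>0 < \<eta>\<close> by simp
  have yD: "y \<in> effdom g" using y by (simp add: S_def)
  have near: "ereal (G y + blinfun_apply q (x - y) - (\<epsilon> + \<eta>) * norm (x - y)) \<le> g x"
    if x: "norm (x - y) < r - \<eta>" for x
  proof (cases "x \<in> effdom g")
    case True
    have "dist x a \<le> r"
      using dist_triangle[of x a y] dy x by (simp add: dist_norm)
    then have "x \<in> S" using True by (simp add: S_def dist_commute)
    from ymin[OF this] have 1: "F y \<le> F x + \<eta> * norm (x - y)" by (simp add: dist_norm)
    have "norm (x - a) \<le> norm (x - y) + norm (y - a)"
      using norm_triangle_ineq[of "x - y" "y - a"] by simp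
    then have "\<epsilon> * norm (x - a) \<le> \<epsilon> * (norm (x - y) + norm (y - a))"
      using \<open>0 \<le> \<epsilon>\<close> by (rule mult_left_mono)
    with 1 show ?thesis
      using gG[OF True] by (simp add: F_def algebra_simps blinfun.diff_right)
  next
    case False
    then show ?thesis by (simp add: effdom_def)
  qed
  have "q \<in> eps_frechet_subdiff (\<epsilon> + \<eta>) g y"
    unfolding eps_frechet_subdiff_iff[of g y, OF g(1)]
  proof (intro conjI allI impI)
    fix \<delta> :: real assume "0 < \<delta>"
    have "ereal (real_of_ereal (g y) + blinfun_apply q (x - y) - (\<epsilon> + \<eta> + \<delta>) * norm (x - y)) \<le> g x"
      if x: "norm (x - y) < r - \<eta>" for x
    proof (rule order_trans[OF _ near[OF x]])
      have "(\<epsilon> + \<eta>) * norm (x - y) \<le> (\<epsilon> + \<eta> + \<delta>) * norm (x - y)"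
        using \<open>0 < \<delta>\<close> by (intro mult_right_mono) auto
      then show "ereal (real_of_ereal (g y) + blinfun_apply q (x - y) - (\<epsilon> + \<eta> + \<delta>) * norm (x - y))
          \<le> ereal (G y + blinfun_apply q (x - y) - (\<epsilon> + \<eta>) * norm (x - y))"
        by (simp add: G_def)
    qed
    then show "\<exists>s>0. \<forall>x. norm (x - y) < s \<longrightarrow> ereal (real_of_ereal (g y) + blinfun_apply q (x - y)
        - (\<epsilon> + \<eta> + \<delta>) * norm (x - y)) \<le> g x"
      using \<open>\<eta> < r\<close> by (intro exI[of _ "r - \<eta>"]) auto
  qed (rule yD)
  with that yD dy show ?thesis by blast
qed

section \<open>Subgradients of an infimal convolution\<close>

lemma inf_conv_le: "inf_conv f \<phi> x \<le> f w + ereal (\<phi> (w - x))"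
  unfolding inf_conv_def by (rule INF_lower) simp

text \<open>
  The value of the convolution at \<open>x'\<close> is bounded above by \<open>f w' + \<phi> (w' - x')\<close> for every \<open>w'\<close>. Two
  choices turn a subgradient inequality for the convolution at \<open>x\<close> into one for a single summand:
  keep the difference \<open>w' - x'\<close> equal to \<open>w - x\<close>, or keep \<open>w' = w\<close>. The sign of \<open>q\<close> flips in the second
  because \<open>x'\<close> enters \<open>\<phi>\<close> negatively.
\<close>

lemma inf_conv_subgradient_splits:
  fixes f :: "'a::banach \<Rightarrow> ereal" and \<phi> :: "'a \<Rightarrow> real"
  assumes f: "\<And>x. f x \<noteq> -\<infinity>" "closed (effdom f)"
      "continuous_on (effdom f) (\<lambda>x. real_of_ereal (f x))"
    and \<phi>: "continuous_on UNIV \<phi>"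
    and hx: "inf_conv f \<phi> x \<noteq> -\<infinity>"
    and q: "q \<in> eps_frechet_subdiff \<epsilon> (inf_conv f \<phi>) x" and "0 \<le> \<epsilon>" "0 < \<eta>"
  obtains w y z where "f w + ereal (\<phi> (w - x)) \<le> inf_conv f \<phi> x + ereal \<eta>"
    "y \<in> effdom f" "dist y w \<le> \<eta>" "q \<in> eps_frechet_subdiff (\<epsilon> + 2 * \<eta>) f y"
    "dist z (w - x) \<le> \<eta>" "- q \<in> eps_frechet_subdiff (\<epsilon> + 2 * \<eta>) (\<lambda>v. ereal (\<phi> v)) z"
proof -
  let ?h = "inf_conv f \<phi>"
  define H where "H = real_of_ereal (?h x)"
  from q have "x \<in> effdom ?h" and "\<forall>\<delta>>0. \<exists>r>0. \<forall>v. norm (v - x) < r \<longrightarrow>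
      ereal (H + blinfun_apply q (v - x) - (\<epsilon> + \<delta>) * norm (v - x)) \<le> ?h v"
    unfolding eps_frechet_subdiff_iff[of ?h, OF hx] H_def by auto
  then obtain r where "r > 0" and r: "\<And>v. norm (v - x) < r \<Longrightarrow>
      ereal (H + blinfun_apply q (v - x) - (\<epsilon> + \<eta>) * norm (v - x)) \<le> ?h v"
    using \<open>0 < \<eta>\<close> by blast
  have hxH: "?h x = ereal H"
    using \<open>x \<in> effdom ?h\<close> hx by (cases "?h x") (auto simp: H_def effdom_def)
  \<comment> \<open>Capping at 1 makes the square at most \<open>\<eta>\<close>; \<open>r / 4\<close> keeps it inside the ball of radius \<open>r / 2\<close>.\<close>
  define \<theta> where "\<theta> = min (min \<eta> 1) (r / 4)"
  have \<theta>: "0 < \<theta>" "\<theta> \<le> \<eta>" "\<theta> \<le> 1" "\<theta> < r / 2"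
    using \<open>0 < \<eta>\<close> \<open>r > 0\<close> by (auto simp: \<theta>_def)
  have "\<theta>\<^sup>2 \<le> \<eta>"
    using mult_mono[of \<theta> \<eta> \<theta> 1] \<theta> \<open>0 < \<eta>\<close> by (simp add: power2_eq_square)
  have "?h x < ereal (H + \<theta>\<^sup>2)" using \<theta> hxH by simp
  then obtain w where w: "f w + ereal (\<phi> (w - x)) < ereal (H + \<theta>\<^sup>2)"
    unfolding inf_conv_def INF_less_iff by auto
  then have wD: "w \<in> effdom f" by (auto simp: effdom_def)
  define W where "W = real_of_ereal (f w)"
  have fw: "f w = ereal W" using wD f(1)[of w] by (cases "f w") (auto simp: W_def effdom_def)
  have wW: "W + \<phi> (w - x) < H + \<theta>\<^sup>2" using w by (simp add: fw)
  \<comment> \<open>Translate \<open>w\<close> together with \<open>x\<close>: only the first summand changes.\<close>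
  have f_almost: "ereal (real_of_ereal (f w) + blinfun_apply q (v - w) - (\<epsilon> + \<eta>) * norm (v - w) - \<theta>\<^sup>2) \<le> f v"
    if "norm (v - w) \<le> r / 2" for v
  proof -
    have "ereal (H + blinfun_apply q (v - w) - (\<epsilon> + \<eta>) * norm (v - w)) \<le> ?h (x + (v - w))"
      using r[of "x + (v - w)"] that \<open>r > 0\<close> by simp
    also have "\<dots> \<le> f v + ereal (\<phi> (w - x))"
      using inf_conv_le[of f \<phi> "x + (v - w)" v] by (simp add: algebra_simps)
    finally show ?thesis
      using wW f(1)[of v] by (cases "f v") (auto simp: fw)
  qed
  \<comment> \<open>Translate \<open>x\<close> alone: only the second summand changes.\<close>
  have \<phi>_almost: "ereal (real_of_ereal (ereal (\<phi> (w - x))) + blinfun_apply (- q) (v - (w - x))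
       - (\<epsilon> + \<eta>) * norm (v - (w - x)) - \<theta>\<^sup>2) \<le> ereal (\<phi> v)"
    if v: "norm (v - (w - x)) \<le> r / 2" for v
  proof -
    have n: "norm (w - v - x) = norm (v - (w - x))"
      using norm_minus_commute[of "w - x" v] by (simp add: algebra_simps)
    have "ereal (H + blinfun_apply q (w - v - x) - (\<epsilon> + \<eta>) * norm (w - v - x)) \<le> ?h (w - v)"
      using r[of "w - v"] v \<open>r > 0\<close> n by simp
    also have "\<dots> \<le> ereal (W + \<phi> v)"
      using inf_conv_le[of f \<phi> "w - v" w] by (simp add: fw)
    finally have "H + blinfun_apply q (w - v - x) - (\<epsilon> + \<eta>) * norm (w - v - x) \<le> W + \<phi> v" by simp
    moreover have "blinfun_apply q (w - v - x) = blinfun_apply (- q) (v - (w - x))"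
      by (simp add: blinfun.diff_right blinfun.minus_left)
    ultimately show ?thesis using wW n by simp
  qed
  have e: "0 \<le> \<epsilon> + \<eta>" using \<open>0 \<le> \<epsilon>\<close> \<open>0 < \<eta>\<close> by simp
  obtain y where y: "y \<in> effdom f" "dist y w \<le> \<theta>" "q \<in> eps_frechet_subdiff (\<epsilon> + \<eta> + \<theta>) f y"
    using almost_subgradient_nearby[OF f wD \<theta>(1,4) e f_almost] by blast
  have "effdom (\<lambda>v. ereal (\<phi> v)) = UNIV" by (simp add: effdom_def)
  then obtain z where z: "dist z (w - x) \<le> \<theta>"
    "- q \<in> eps_frechet_subdiff (\<epsilon> + \<eta> + \<theta>) (\<lambda>v. ereal (\<phi> v)) z"
    using almost_subgradient_nearby[of "\<lambda>v. ereal (\<phi> v)", OF _ _ _ _ \<theta>(1,4) e \<phi>_almost] \<phi> by auto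
  have "\<epsilon> + \<eta> + \<theta> \<le> \<epsilon> + 2 * \<eta>" using \<theta> by simp
  note mono = eps_frechet_subdiff_mono[OF this]
  show ?thesis
  proof (rule that)
    show "f w + ereal (\<phi> (w - x)) \<le> ?h x + ereal \<eta>"
      using wW \<open>\<theta>\<^sup>2 \<le> \<eta>\<close> by (simp add: fw hxH)
  qed (use y z \<theta> mono in \<open>auto intro: order_trans\<close>)
qed

section \<open>Limiting subgradients of a sublinear function at the origin\<close>

text \<open>
  By subadditivity the increment \<open>\<phi> (z + v) - \<phi> z\<close> is at most \<open>\<phi> v\<close>. A subgradient inequality at any
  base point \<open>z\<close> is thus one at \<open>0\<close>, valid for small \<open>v\<close>; homogeneity extends it to all \<open>v\<close>, and it
  survives the weak* limit.
\<close>

lemma linear_bound_of_limiting_subgradient_at_0: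
  fixes \<phi> :: "'a::real_normed_vector \<Rightarrow> real"
  assumes subadd: "\<And>x y. \<phi> (x + y) \<le> \<phi> x + \<phi> y"
    and hom: "\<And>t x. t > 0 \<Longrightarrow> \<phi> (t *\<^sub>R x) = t * \<phi> x"
    and s: "s \<in> limiting_subdiff (\<lambda>x. ereal (\<phi> x)) 0"
  shows "blinfun_apply s v \<le> \<phi> v"
proof -
  obtain \<epsilon> z q where \<epsilon>: "\<epsilon> \<longlonglongrightarrow> (0::real)"
    and q: "\<And>k::nat. q k \<in> eps_frechet_subdiff (\<epsilon> k) (\<lambda>x. ereal (\<phi> x)) (z k)"
    and lim: "(\<lambda>k. blinfun_apply (q k) v) \<longlonglongrightarrow> blinfun_apply s v"
    using s unfolding limiting_subdiff_def by blast
  have le: "blinfun_apply (q k) v - (\<epsilon> k + \<delta>) * norm v \<le> \<phi> v" if "0 < \<delta>" for k \<delta>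
  proof -
    obtain r where "r > 0" and r: "\<And>x. norm (x - z k) < r \<Longrightarrow>
       \<phi> (z k) + blinfun_apply (q k) (x - z k) - (\<epsilon> k + \<delta>) * norm (x - z k) \<le> \<phi> x"
      using q[of k] \<open>0 < \<delta>\<close> by (subst (asm) eps_frechet_subdiff_iff) auto
    \<comment> \<open>Shrink \<open>v\<close> into the neighbourhood; the added 1 covers \<open>v = 0\<close>.\<close>
    define t where "t = r / (norm v + 1) / 2"
    have t: "t > 0" using \<open>r > 0\<close> by (simp add: t_def add_nonneg_pos)
    have "t * norm v < r"
      using \<open>r > 0\<close> by (simp add: t_def field_simps add_nonneg_pos add_strict_increasing)
    then have "\<phi> (z k) + t * blinfun_apply (q k) v - (\<epsilon> k + \<delta>) * (t * norm v) \<le> \<phi> (z k + t *\<^sub>R v)"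
      using r[of "z k + t *\<^sub>R v"] t by (simp add: blinfun.scaleR_right)
    also have "\<dots> \<le> \<phi> (z k) + t * \<phi> v" using subadd[of "z k" "t *\<^sub>R v"] hom[OF t] by simp
    finally have "t * (blinfun_apply (q k) v - (\<epsilon> k + \<delta>) * norm v) \<le> t * \<phi> v"
      by (simp add: algebra_simps)
    then show ?thesis using t by simp
  qed
  have "blinfun_apply s v - (0 + 0) * norm v \<le> \<phi> v"
  proof (rule LIMSEQ_le_const2)
    show "(\<lambda>k. blinfun_apply (q k) v - (\<epsilon> k + inverse (real (Suc k))) * norm v)
        \<longlonglongrightarrow> blinfun_apply s v - (0 + 0) * norm v"
      by (intro tendsto_intros lim \<epsilon> LIMSEQ_inverse_real_of_nat)
    show "\<exists>N. \<forall>k\<ge>N. blinfun_apply (q k) v - (\<epsilon> k + inverse (real (Suc k))) * norm v \<le> \<phi> v"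
      using le by auto
  qed
  then show ?thesis by simp
qed

section \<open>Pointwise and norm convergence in finite dimension\<close>

text \<open>
  The coefficient vectors of \<open>l\<^sup>1\<close>-norm 1 form a compact set in the product topology on functions,
  where the norm of the linear combination is continuous and, by independence, never \<open>0\<close>. If the
  set is nonempty, that norm has a positive minimum on it, and scaling does the rest.
\<close>

lemma independent_coordinates_bounded:
  fixes C :: "'a::real_normed_vector set"
  assumes C: "finite C" "independent C"
  obtains \<mu> where "\<mu> > 0" "\<And>c. \<mu> * (\<Sum>b\<in>C. \<bar>c b\<bar>) \<le> norm (\<Sum>b\<in>C. c b *\<^sub>R b)"
proof -
  \<comment> \<open>Coefficients are forced to be 0 off \<open>C\<close>; otherwise the product would not be compact.\<close>
  define P :: "('a \<Rightarrow> real) set" where "P = PiE UNIV (\<lambda>b. if b \<in> C then {-1..1} else {0})"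
  define S where "S = P \<inter> {c. (\<Sum>b\<in>C. \<bar>c b\<bar>) = 1}"
  have "compactin (product_topology (\<lambda>_. euclidean) UNIV) P"
    unfolding P_def compactin_PiE by auto
  then have "compact P"
    by (simp add: euclidean_product_topology)
  moreover have "closed {c :: 'a \<Rightarrow> real. (\<Sum>b\<in>C. \<bar>c b\<bar>) = 1}"
    by (intro closed_Collect_eq continuous_intros continuous_on_product_coordinates)
  ultimately have "compact S" unfolding S_def by (rule compact_Int_closed)
  have scale: "(\<lambda>b. if b \<in> C then c b / (\<Sum>b\<in>C. \<bar>c b\<bar>) else 0) \<in> S" (is "?c \<in> S")
    if "(\<Sum>b\<in>C. \<bar>c b\<bar>) \<noteq> 0" for c
  proof -
    let ?s = "\<Sum>b\<in>C. \<bar>c b\<bar>"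
    have s: "?s > 0" using that by (simp add: sum_nonneg order_less_le)
    have "\<bar>c b\<bar> \<le> ?s" if "b \<in> C" for b using that C by (intro member_le_sum) auto
    then have "?c b \<in> {-1..1}" if "b \<in> C" for b
      using that s by (fastforce simp: abs_le_iff field_simps)
    moreover have "(\<Sum>b\<in>C. \<bar>?c b\<bar>) = 1"
    proof -
      have "(\<Sum>b\<in>C. \<bar>?c b\<bar>) = (\<Sum>b\<in>C. \<bar>c b\<bar> / ?s)"
        using s by (intro sum.cong) auto
      then show ?thesis using s by (simp add: sum_divide_distrib[symmetric])
    qed
    ultimately show ?thesis unfolding S_def P_def by auto
  qed
  show ?thesis
  proof (cases "S = {}")
    case True
    then show ?thesis using scale by (intro that[of 1]) fastforce+
  next
    case False
    have "continuous_on S (\<lambda>c. norm (\<Sum>b\<in>C. c b *\<^sub>R b))"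
      by (intro continuous_intros continuous_on_subset[OF continuous_on_product_coordinates]) auto
    then obtain c0 where c0: "c0 \<in> S"
      and min: "\<And>c. c \<in> S \<Longrightarrow> norm (\<Sum>b\<in>C. c0 b *\<^sub>R b) \<le> norm (\<Sum>b\<in>C. c b *\<^sub>R b)"
      using continuous_attains_inf[OF \<open>compact S\<close> False] by blast
    let ?\<mu> = "norm (\<Sum>b\<in>C. c0 b *\<^sub>R b)"
    show ?thesis
    proof (rule that)
      show "0 < ?\<mu>"
      proof (rule ccontr)
        assume "\<not> ?thesis"
        then have "(\<Sum>b\<in>C. c0 b *\<^sub>R b) = 0" by simp
        then have "\<forall>b\<in>C. c0 b = 0" using independentD[OF C(2,1)] by blast
        then show False using c0 by (simp add: S_def)
      qed
      fix c :: "'a \<Rightarrow> real"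
      let ?s = "\<Sum>b\<in>C. \<bar>c b\<bar>"
      show "?\<mu> * ?s \<le> norm (\<Sum>b\<in>C. c b *\<^sub>R b)"
      proof (cases "?s = 0")
        case False
        then have s: "?s > 0" by (simp add: sum_nonneg order_less_le)
        have "(\<Sum>b\<in>C. c b *\<^sub>R b) = ?s *\<^sub>R (\<Sum>b\<in>C. (if b \<in> C then c b / ?s else 0) *\<^sub>R b)"
          unfolding scaleR_sum_right using False by (intro sum.cong) auto
        from arg_cong[OF this, of norm] have "norm (\<Sum>b\<in>C. c b *\<^sub>R b) =
            ?s * norm (\<Sum>b\<in>C. (if b \<in> C then c b / ?s else 0) *\<^sub>R b)"
          using s by (simp only: norm_scaleR abs_of_pos)
        then show ?thesis
          using mult_left_mono[OF min[OF scale[OF False]], of ?s] s by (simp add: mult.commute)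
      qed simp
    qed
  qed
qed

text \<open>
  Bounded coordinates make the operator norm at most a constant times the sum of the norms of the
  values on a basis, and pointwise convergence controls each of these finitely many values.
\<close>

lemma finite_dim_blinfun_tendsto:
  fixes q :: "nat \<Rightarrow> 'a::real_normed_vector \<Rightarrow>\<^sub>L 'b::real_normed_vector" and B :: "'a set"
  assumes B: "finite B" "span B = UNIV"
    and lim: "\<And>v. (\<lambda>k. blinfun_apply (q k) v) \<longlonglongrightarrow> blinfun_apply p v"
  shows "q \<longlonglongrightarrow> p"
proof -
  obtain C where C: "C \<subseteq> B" "independent C" "B \<subseteq> span C"
    using maximal_independent_subset[of B] by blast
  have fin: "finite C" using C B finite_subset by blast
  have span: "span C = UNIV"
    using C(3) B(2) by (metis span_mono span_span top.extremum_unique)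
  obtain \<mu> where \<mu>: "\<mu> > 0" "\<And>c. \<mu> * (\<Sum>b\<in>C. \<bar>c b\<bar>) \<le> norm (\<Sum>b\<in>C. c b *\<^sub>R b)"
    using independent_coordinates_bounded[OF fin C(2)] by metis
  have bound: "norm T \<le> (\<Sum>b\<in>C. norm (blinfun_apply T b)) / \<mu>" (is "_ \<le> ?N / \<mu>")
    for T :: "'a \<Rightarrow>\<^sub>L 'b"
  proof (rule norm_blinfun_bound)
    show "0 \<le> ?N / \<mu>" using \<mu> by (simp add: sum_nonneg)
    fix v
    have "v \<in> span C" using span by simp
    then obtain c where v: "v = (\<Sum>b\<in>C. c b *\<^sub>R b)"
      unfolding span_finite[OF fin] by auto
    have "norm (blinfun_apply T v) \<le> (\<Sum>b\<in>C. \<bar>c b\<bar> * norm (blinfun_apply T b))"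
      unfolding v blinfun.sum_right blinfun.scaleR_right by (rule sum_norm_le) simp
    also have "\<dots> \<le> (\<Sum>b\<in>C. \<bar>c b\<bar> * ?N)"
      using fin by (intro sum_mono mult_left_mono member_le_sum) auto
    also have "\<dots> = ?N * (\<Sum>b\<in>C. \<bar>c b\<bar>)" by (simp add: sum_distrib_right mult.commute)
    also have "\<dots> \<le> ?N * (norm v / \<mu>)"
      using \<mu>(1) \<mu>(2)[of c] by (intro mult_left_mono) (auto simp: v field_simps sum_nonneg)
    finally show "norm (blinfun_apply T v) \<le> ?N / \<mu> * norm v" by simp
  qed
  have "(\<lambda>k. (\<Sum>b\<in>C. norm (blinfun_apply (q k) b - blinfun_apply p b)) / \<mu>) \<longlonglongrightarrow>
      (\<Sum>b\<in>C. norm (blinfun_apply p b - blinfun_apply p b)) / \<mu>"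
    using \<mu> by (intro tendsto_intros lim) auto
  then have "(\<lambda>k. (\<Sum>b\<in>C. norm (blinfun_apply (q k - p) b)) / \<mu>) \<longlonglongrightarrow> 0"
    by (simp add: blinfun.diff_left)
  then have "(\<lambda>k. q k - p) \<longlonglongrightarrow> 0"
    by (rule Lim_null_comparison[rotated]) (simp add: bound)
  then show ?thesis by (simp add: LIM_zero_iff)
qed

section \<open>Kernels steeper than the function\<close>

locale steep_inf_conv =
  fixes f :: "'a::banach \<Rightarrow> ereal" and \<phi> :: "'a \<Rightarrow> real" and m l :: real
  assumes f_not_minf: "f x \<noteq> -\<infinity>"
    and coercive: "m * norm x \<le> \<phi> x"
    and lsc: "lower_semicontinuous f"
    and lipschitz: "l-lipschitz_on (effdom f) (\<lambda>x. real_of_ereal (f x))"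
    and l_less: "l < m"
    and subadd: "\<phi> (x + y) \<le> \<phi> x + \<phi> y"
    and cont0: "isCont \<phi> 0"
    and phi0: "\<phi> 0 = 0"
begin

definition F :: "'a \<Rightarrow> real" where
  "F x = real_of_ereal (f x)"

lemma l_nonneg: "0 \<le> l"
  using lipschitz by (rule lipschitz_on_nonneg)

lemma f_eq: "x \<in> effdom f \<Longrightarrow> f x = ereal (F x)"
  using f_not_minf[of x] by (cases "f x") (auto simp: effdom_def F_def)

lemma f_outside: "x \<notin> effdom f \<Longrightarrow> f x = \<infinity>"
  by (simp add: effdom_def)

lemma F_lipschitz: "x \<in> effdom f \<Longrightarrow> y \<in> effdom f \<Longrightarrow> \<bar>F x - F y\<bar> \<le> l * norm (x - y)"
  using lipschitz_on_normD[OF lipschitz, of x y] by (simp add: F_def)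

text \<open>
  Moving from \<open>a\<close> to \<open>w\<close> lowers \<open>f\<close> by at most \<open>l * norm (w - a)\<close>, while \<open>\<phi> (w - x)\<close> costs at least
  \<open>m * (norm (w - a) - norm (x - a))\<close>.
\<close>

lemma growth:
  assumes a: "a \<in> effdom f"
  shows "ereal (F a + (m - l) * norm (w - a) - m * norm (x - a)) \<le> f w + ereal (\<phi> (w - x))"
proof (cases "w \<in> effdom f")
  case True
  have "m * norm (w - a) \<le> m * (norm (w - x) + norm (x - a))"
    using l_nonneg l_less norm_triangle_ineq[of "w - x" "x - a"] by (intro mult_left_mono) auto
  then show ?thesis
    using F_lipschitz[OF True a] coercive[of "w - x"] by (simp add: f_eq[OF True] algebra_simps)
qed (simp add: f_outside)

lemma inf_conv_eq:
  assumes a: "a \<in> effdom f"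
  shows "inf_conv f \<phi> a = f a"
proof (rule antisym)
  show "inf_conv f \<phi> a \<le> f a" using inf_conv_le[of f \<phi> a a] by (simp add: phi0)
  have "f a \<le> f w + ereal (\<phi> (w - a))" for w
  proof -
    have "f a \<le> ereal (F a + (m - l) * norm (w - a) - m * norm (a - a))"
      using l_less by (simp add: f_eq[OF a])
    also have "\<dots> \<le> f w + ereal (\<phi> (w - a))" by (rule growth[OF a])
    finally show ?thesis .
  qed
  then show "f a \<le> inf_conv f \<phi> a" unfolding inf_conv_def by (rule INF_greatest)
qed

lemma inf_conv_not_minf:
  assumes a: "a \<in> effdom f"
  shows "inf_conv f \<phi> x \<noteq> -\<infinity>"
proof -
  have "ereal (F a - m * norm (x - a)) \<le> f w + ereal (\<phi> (w - x))" for w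
    using l_less by (intro order_trans[OF _ growth[OF a, of w x]]) simp
  then have "ereal (F a - m * norm (x - a)) \<le> inf_conv f \<phi> x"
    unfolding inf_conv_def by (rule INF_greatest)
  then show ?thesis by auto
qed

text \<open>
  At a limit point of the domain the Lipschitz bound keeps \<open>f\<close> bounded along the domain, so lower
  semicontinuity rules out the value \<open>\<infinity>\<close> there.
\<close>

lemma closed_effdom: "closed (effdom f)"
proof (cases "effdom f = {}")
  case False
  then obtain d where d: "d \<in> effdom f" by blast
  have "eventually (\<lambda>y. y \<in> - effdom f) (nhds x)" if x: "x \<in> - effdom f" for x
  proof -
    \<comment> \<open>A bound for \<open>f\<close> on the part of its domain within distance 1 of \<open>x\<close>.\<close>
    define M where "M = F d + l * (norm (x - d) + 1)"
    have "\<infinity> \<le> Liminf (at x) f"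
      using lsc x f_outside[of x] by (metis ComplD lower_semicontinuous_def)
    then have "eventually (\<lambda>y. ereal M < f y) (at x)"
      unfolding le_Liminf_iff by simp
    moreover have "eventually (\<lambda>y. norm (y - x) < 1) (at x)"
      unfolding eventually_at by (intro exI[of _ 1]) (simp add: dist_norm)
    ultimately have "eventually (\<lambda>y. y \<in> - effdom f) (at x)"
    proof eventually_elim
      case (elim y)
      show ?case
      proof
        assume y: "y \<in> effdom f"
        have "l * norm (y - d) \<le> l * (norm (x - d) + 1)"
          using elim(2) l_nonneg norm_triangle_ineq[of "y - x" "x - d"]
          by (intro mult_left_mono) auto
        then have "F y \<le> M" using F_lipschitz[OF y d] by (simp add: M_def)
        then show False using elim(1) f_eq[OF y] by simp
      qed
    qed
    then show ?thesis using x by (simp add: eventually_nhds_conv_at)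
  qed
  then have "\<exists>T. open T \<and> x \<in> T \<and> T \<subseteq> - effdom f" if "x \<in> - effdom f" for x
    using that unfolding eventually_nhds by (metis subsetI)
  then show ?thesis
    unfolding closed_def open_subopen[of "- effdom f"] by blast
qed simp

text \<open>
  Subadditivity bounds \<open>\<phi> (x + h) - \<phi> x\<close> between \<open>- \<phi> (- h)\<close> and \<open>\<phi> h\<close>, which carries continuity at
  \<open>0\<close> to every point.
\<close>

lemma continuous_\<phi>: "continuous_on UNIV \<phi>"
proof -
  have "(\<phi> \<longlongrightarrow> \<phi> x) (at x)" for x
  proof (rule LIM_offset_zero_cancel, rule LIM_zero_cancel)
    have "(\<lambda>h. \<phi> h + \<phi> (- h)) \<midarrow>0\<rightarrow> \<phi> 0 + \<phi> (- 0)"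
    proof (intro tendsto_add)
      show "\<phi> \<midarrow>0\<rightarrow> \<phi> 0" using cont0 by (simp add: isCont_def)
      have "isCont (\<lambda>h. \<phi> (- h)) 0"
        by (rule isCont_o2[where f = uminus]) (use cont0 in auto)
      then show "(\<lambda>h. \<phi> (- h)) \<midarrow>0\<rightarrow> \<phi> (- 0)" by (simp add: isCont_def)
    qed
    then have "(\<lambda>h. \<phi> h + \<phi> (- h)) \<midarrow>0\<rightarrow> 0" by (simp add: phi0)
    moreover have "norm (\<phi> (x + h) - \<phi> x) \<le> \<phi> h + \<phi> (- h)" for h
    proof -
      have "0 \<le> \<phi> v" for v
        using coercive[of v] l_nonneg l_less by (metis mult_nonneg_nonneg norm_ge_zero order_trans less_imp_le)
      then show ?thesis
        using subadd[of x h] subadd[of "x + h" "- h"] by (simp add: abs_le_iff add_increasing add_increasing2)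
    qed
    ultimately show "(\<lambda>h. \<phi> (x + h) - \<phi> x) \<midarrow>0\<rightarrow> 0"
      by (rule Lim_null_comparison[OF always_eventually[OF allI], rotated])
  qed
  then show ?thesis by (simp add: continuous_on_def)
qed

text \<open>
  Splitting each \<open>q k\<close> gives base points \<open>y k\<close> near a near minimizer \<open>w k\<close>, and \<open>z k\<close> near
  \<open>w k - x k\<close>. The growth estimate forces \<open>w k\<close> to \<open>a\<close>, because the values of the convolution at \<open>x k\<close>
  tend to \<open>f a\<close>.
\<close>

lemma limiting_subdiff_inf_conv_subset:
  assumes a: "a \<in> effdom f" and p: "p \<in> limiting_subdiff (inf_conv f \<phi>) a"
  shows "p \<in> limiting_subdiff f a" "- p \<in> limiting_subdiff (\<lambda>x. ereal (\<phi> x)) 0"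
proof -
  let ?h = "inf_conv f \<phi>"
  obtain \<epsilon> x q where "decseq \<epsilon>" and \<epsilon>: "\<epsilon> \<longlonglongrightarrow> (0::real)" and x: "x \<longlonglongrightarrow> a"
    and hx: "(\<lambda>k. ?h (x k)) \<longlonglongrightarrow> ?h a"
    and q: "\<And>k::nat. q k \<in> eps_frechet_subdiff (\<epsilon> k) ?h (x k)"
    and lim: "\<And>v. (\<lambda>k. blinfun_apply (q k) v) \<longlonglongrightarrow> blinfun_apply p v"
    using p unfolding limiting_subdiff_def by blast
  have \<epsilon>_ge: "0 \<le> \<epsilon> k" for k using decseq_ge[OF \<open>decseq \<epsilon>\<close> \<epsilon>] .
  define \<eta> where "\<eta> k = inverse (real (Suc k))" for k
  have \<eta>: "\<eta> \<longlonglongrightarrow> 0" unfolding \<eta>_def by (rule LIMSEQ_inverse_real_of_nat)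
  note cont = lipschitz_on_continuous_on[OF lipschitz]
  have "\<exists>w y z. f w + ereal (\<phi> (w - x k)) \<le> ?h (x k) + ereal (\<eta> k) \<and> y \<in> effdom f \<and>
      dist y w \<le> \<eta> k \<and> q k \<in> eps_frechet_subdiff (\<epsilon> k + 2 * \<eta> k) f y \<and> dist z (w - x k) \<le> \<eta> k \<and>
      - q k \<in> eps_frechet_subdiff (\<epsilon> k + 2 * \<eta> k) (\<lambda>v. ereal (\<phi> v)) z" for k
    by (rule inf_conv_subgradient_splits[OF f_not_minf closed_effdom cont continuous_\<phi>
        inf_conv_not_minf[OF a] q[of k] \<epsilon>_ge, of "\<eta> k"]) (auto simp: \<eta>_def)
  then obtain w y z where w: "\<And>k. f (w k) + ereal (\<phi> (w k - x k)) \<le> ?h (x k) + ereal (\<eta> k)"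
    and y: "\<And>k. y k \<in> effdom f" "\<And>k. dist (y k) (w k) \<le> \<eta> k"
      "\<And>k. q k \<in> eps_frechet_subdiff (\<epsilon> k + 2 * \<eta> k) f (y k)"
    and z: "\<And>k. dist (z k) (w k - x k) \<le> \<eta> k"
      "\<And>k. - q k \<in> eps_frechet_subdiff (\<epsilon> k + 2 * \<eta> k) (\<lambda>v. ereal (\<phi> v)) (z k)"
    by metis
  have x0: "(\<lambda>k. norm (x k - a)) \<longlonglongrightarrow> 0"
    using x by (simp add: LIM_zero tendsto_norm_zero)
  have H: "(\<lambda>k. real_of_ereal (?h (x k))) \<longlonglongrightarrow> F a"
    using hx f_eq[OF a] by (auto simp: inf_conv_eq[OF a] intro: lim_real_of_ereal)
  have w_le: "norm (w k - a) \<le> (real_of_ereal (?h (x k)) - F a + \<eta> k + m * norm (x k - a)) / (m - l)" for k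
  proof -
    have "?h (x k) = ereal (real_of_ereal (?h (x k)))"
      using q[of k] inf_conv_not_minf[OF a, of "x k"]
      by (cases "?h (x k)") (auto simp: eps_frechet_subdiff_def effdom_def)
    then have "ereal (F a + (m - l) * norm (w k - a) - m * norm (x k - a))
        \<le> ereal (real_of_ereal (?h (x k)) + \<eta> k)"
      using order_trans[OF growth[OF a, of "w k" "x k"] w[of k]] by (metis plus_ereal.simps(1))
    then show ?thesis using l_less by (simp add: field_simps)
  qed
  have "(\<lambda>k. (real_of_ereal (?h (x k)) - F a + \<eta> k + m * norm (x k - a)) / (m - l))
     \<longlonglongrightarrow> (F a - F a + 0 + m * 0) / (m - l)"
    using l_less by (intro tendsto_intros H \<eta> x0) auto
  then have w0: "(\<lambda>k. norm (w k - a)) \<longlonglongrightarrow> 0"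
    by (intro tendsto_norm_zero Lim_null_comparison[OF always_eventually[OF allI, OF w_le]]) simp
  have "(\<lambda>k. \<eta> k + norm (w k - a)) \<longlonglongrightarrow> 0" using tendsto_add[OF \<eta> w0] by simp
  moreover have "norm (y k - a) \<le> \<eta> k + norm (w k - a)" for k
    using y(2)[of k] norm_triangle_ineq[of "y k - w k" "w k - a"] by (simp add: dist_norm)
  ultimately have y0: "(\<lambda>k. y k - a) \<longlonglongrightarrow> 0"
    by (rule Lim_null_comparison[OF always_eventually[OF allI], rotated])
  have "(\<lambda>k. \<eta> k + (norm (w k - a) + norm (x k - a))) \<longlonglongrightarrow> 0"
    using tendsto_add[OF \<eta> tendsto_add[OF w0 x0]] by simp
  moreover have "norm (z k) \<le> \<eta> k + (norm (w k - a) + norm (x k - a))" for k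
    using z(1)[of k] norm_triangle_ineq[of "z k - (w k - x k)" "w k - x k"]
      norm_triangle_ineq4[of "w k - a" "x k - a"] by (simp add: dist_norm)
  ultimately have z0: "z \<longlonglongrightarrow> 0"
    by (rule Lim_null_comparison[OF always_eventually[OF allI], rotated])
  have e0: "(\<lambda>k. \<epsilon> k + 2 * \<eta> k) \<longlonglongrightarrow> 0"
    using tendsto_add[OF \<epsilon> tendsto_mult_left[OF \<eta>, of 2]] by simp
  show "p \<in> limiting_subdiff f a"
  proof (rule limiting_subdiffI[OF a e0 _ _ y(3) lim])
    show y_lim: "y \<longlonglongrightarrow> a" using y0 by (simp add: LIM_zero_iff)
    have "(\<lambda>k. F (y k)) \<longlonglongrightarrow> F a"
      using continuous_on_tendsto_compose[OF cont y_lim a] y(1) by (simp add: F_def)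
    then show "(\<lambda>k. f (y k)) \<longlonglongrightarrow> f a" using f_eq[OF y(1)] f_eq[OF a] by simp
  qed
  show "- p \<in> limiting_subdiff (\<lambda>x. ereal (\<phi> x)) 0"
  proof (rule limiting_subdiffI[OF _ e0 z0 _ z(2)])
    have "(\<lambda>k. \<phi> (z k)) \<longlonglongrightarrow> \<phi> 0" by (rule isCont_tendsto_compose[OF cont0 z0])
    then show "(\<lambda>k. ereal (\<phi> (z k))) \<longlonglongrightarrow> ereal (\<phi> 0)" by simp
    show "(\<lambda>k. blinfun_apply (- q k) v) \<longlonglongrightarrow> blinfun_apply (- p) v" for v
      using tendsto_minus[OF lim] by (simp add: blinfun.minus_left)
  qed (simp add: effdom_def)
qed

text \<open>
  If \<open>norm (w - a)\<close> is at least \<open>C * norm (x - a)\<close>, the growth estimate alone beats the linear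
  function \<open>q\<close>; this is what determines \<open>C\<close>. For the other \<open>w\<close> the inequalities for \<open>f\<close> at \<open>w\<close> and for
  \<open>\<phi>\<close> at \<open>w - x\<close> add up, and the errors \<open>\<epsilon> * norm (w - a)\<close> and \<open>\<kappa> * norm (w - x)\<close> are bounded by multiples
  \<open>C * \<epsilon>\<close> and \<open>(C + 1) * \<kappa>\<close> of \<open>norm (x - a)\<close>.
\<close>

lemma eps_frechet_subdiff_inf_convI:
  assumes q: "q \<in> eps_frechet_subdiff \<epsilon> f a" and "0 \<le> \<epsilon>" "0 \<le> \<kappa>"
    and bound: "\<And>v. - blinfun_apply q v \<le> \<phi> v + \<kappa> * norm v"
  defines "C \<equiv> (m + norm q) / (m - l)"
  shows "q \<in> eps_frechet_subdiff (C * \<epsilon> + (C + 1) * \<kappa>) (inf_conv f \<phi>) a"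
proof -
  have a: "a \<in> effdom f" using q by (simp add: eps_frechet_subdiff_def)
  have C: "0 \<le> C" "(m - l) * C = m + norm q" using l_nonneg l_less by (auto simp: C_def)
  have aD: "a \<in> effdom (inf_conv f \<phi>)" using a by (simp add: effdom_def inf_conv_eq)
  show ?thesis
    unfolding eps_frechet_subdiff_iff[of "inf_conv f \<phi>" a, OF inf_conv_not_minf[OF a]]
  proof (intro conjI allI impI aD)
    fix \<delta> :: real assume "0 < \<delta>"
    define \<theta> where "\<theta> = \<delta> / (C + 1)"
    have \<theta>: "0 < \<theta>" "C * \<theta> \<le> \<delta>"
      using C \<open>0 < \<delta>\<close> by (auto simp: \<theta>_def field_simps)
    obtain r where "r > 0" and r: "\<And>w. norm (w - a) < r \<Longrightarrow>
        ereal (F a + blinfun_apply q (w - a) - (\<epsilon> + \<theta>) * norm (w - a)) \<le> f w"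
      using q \<theta>(1) unfolding eps_frechet_subdiff_iff[of f, OF f_not_minf] F_def by blast
    have "ereal (F a + blinfun_apply q (x - a) - (C * \<epsilon> + (C + 1) * \<kappa> + \<delta>) * norm (x - a))
        \<le> f w + ereal (\<phi> (w - x))" if x: "norm (x - a) < r / (C + 1)" for x w
    proof (cases "C * norm (x - a) \<le> norm (w - a)")
      case True
      have "(m + norm q) * norm (x - a) \<le> (m - l) * norm (w - a)"
        using mult_left_mono[OF True, of "m - l"] l_less C by (simp add: mult.assoc[symmetric])
      moreover have "blinfun_apply q (x - a) \<le> norm q * norm (x - a)"
        using norm_blinfun[of q "x - a"] by simp
      moreover have "0 \<le> (C * \<epsilon> + (C + 1) * \<kappa> + \<delta>) * norm (x - a)"
        using C \<open>0 \<le> \<epsilon>\<close> \<open>0 \<le> \<kappa>\<close> \<open>0 < \<delta>\<close> by simp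
      ultimately show ?thesis
        by (intro order_trans[OF _ growth[OF a, of w x]]) (simp add: algebra_simps)
    next
      case False
      have "norm (w - a) < r"
      proof -
        have "norm (w - a) < C * norm (x - a)" using False by simp
        also have "\<dots> \<le> (C + 1) * norm (x - a)" by (simp add: mult_right_mono)
        also have "\<dots> < r" using x C by (simp add: field_simps)
        finally show ?thesis .
      qed
      note fw = r[OF this]
      have "norm (w - x) \<le> (C + 1) * norm (x - a)"
        using False norm_triangle_ineq4[of "w - a" "x - a"] by (simp add: algebra_simps)
      from mult_left_mono[OF this \<open>0 \<le> \<kappa>\<close>]
      have 1: "\<kappa> * norm (w - x) \<le> (C + 1) * \<kappa> * norm (x - a)" by (simp add: mult.left_commute mult.assoc)
      have "(\<epsilon> + \<theta>) * norm (w - a) \<le> (\<epsilon> + \<theta>) * (C * norm (x - a))"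
        using False \<theta> \<open>0 \<le> \<epsilon>\<close> by (intro mult_left_mono) auto
      also have "\<dots> = C * \<epsilon> * norm (x - a) + C * \<theta> * norm (x - a)" by (simp add: algebra_simps)
      also have "\<dots> \<le> C * \<epsilon> * norm (x - a) + \<delta> * norm (x - a)"
        using \<theta> by (intro add_left_mono mult_right_mono) auto
      finally have 2: "(\<epsilon> + \<theta>) * norm (w - a) \<le> C * \<epsilon> * norm (x - a) + \<delta> * norm (x - a)" .
      have "blinfun_apply q (x - a) = blinfun_apply q (w - a) - blinfun_apply q (w - x)"
        by (simp add: blinfun.diff_right)
      with 1 2 bound[of "w - x"]
      have "F a + blinfun_apply q (x - a) - (C * \<epsilon> + (C + 1) * \<kappa> + \<delta>) * norm (x - a)
          \<le> F a + blinfun_apply q (w - a) - (\<epsilon> + \<theta>) * norm (w - a) + \<phi> (w - x)"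
        by (simp add: distrib_right)
      then show ?thesis using fw f_not_minf[of w] by (cases "f w") auto
    qed
    then have "ereal (F a + blinfun_apply q (x - a) - (C * \<epsilon> + (C + 1) * \<kappa> + \<delta>) * norm (x - a))
        \<le> inf_conv f \<phi> x" if "norm (x - a) < r / (C + 1)" for x
      unfolding inf_conv_def using that by (intro INF_greatest) auto
    then show "\<exists>s>0. \<forall>x. norm (x - a) < s \<longrightarrow> ereal (real_of_ereal (inf_conv f \<phi> a)
        + blinfun_apply q (x - a) - (C * \<epsilon> + (C + 1) * \<kappa> + \<delta>) * norm (x - a)) \<le> inf_conv f \<phi> x"
      using \<open>r > 0\<close> C by (intro exI[of _ "r / (C + 1)"]) (simp add: inf_conv_eq[OF a] F_def)
  qed
qed

text \<open>
  A linear minorant \<open>- p\<close> of \<open>\<phi>\<close> makes \<open>- q k\<close> a minorant up to \<open>norm (q k - p)\<close> times the norm. This is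
  why norm convergence of \<open>q\<close> is required, where the limiting subdifferential provides only weak*
  convergence.
\<close>

lemma limiting_subdiff_inf_convI:
  fixes q :: "nat \<Rightarrow> 'a \<Rightarrow>\<^sub>L real"
  assumes a: "a \<in> effdom f" and dec: "decseq \<epsilon>" and \<epsilon>: "\<epsilon> \<longlonglongrightarrow> 0" and x: "x \<longlonglongrightarrow> a"
    and fx: "(\<lambda>k. f (x k)) \<longlonglongrightarrow> f a" and q: "\<And>k. q k \<in> eps_frechet_subdiff (\<epsilon> k) f (x k)"
    and lim: "q \<longlonglongrightarrow> p"
    and bound: "\<And>v. - blinfun_apply p v \<le> \<phi> v"
  shows "p \<in> limiting_subdiff (inf_conv f \<phi>) a"
proof -
  define C where "C k = (m + norm (q k)) / (m - l)" for k
  define \<kappa> where "\<kappa> k = norm (q k - p)" for k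
  have "C \<longlonglongrightarrow> (m + norm p) / (m - l)"
    unfolding C_def using l_less by (intro tendsto_intros lim) auto
  moreover have \<kappa>: "\<kappa> \<longlonglongrightarrow> 0"
    unfolding \<kappa>_def using lim by (simp add: LIM_zero tendsto_norm_zero)
  ultimately have "(\<lambda>k. C k * \<epsilon> k + (C k + 1) * \<kappa> k) \<longlonglongrightarrow>
      (m + norm p) / (m - l) * 0 + ((m + norm p) / (m - l) + 1) * 0"
    by (intro tendsto_intros \<epsilon>)
  then have e0: "(\<lambda>k. C k * \<epsilon> k + (C k + 1) * \<kappa> k) \<longlonglongrightarrow> 0" by simp
  have xD: "x k \<in> effdom f" for k using q[of k] by (simp add: eps_frechet_subdiff_def)
  show ?thesis
  proof (rule limiting_subdiffI[OF _ e0 x])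
    show "a \<in> effdom (inf_conv f \<phi>)" using a by (simp add: effdom_def inf_conv_eq)
    show "(\<lambda>k. inf_conv f \<phi> (x k)) \<longlonglongrightarrow> inf_conv f \<phi> a"
      using fx by (simp add: inf_conv_eq[OF xD] inf_conv_eq[OF a])
    show "q k \<in> eps_frechet_subdiff (C k * \<epsilon> k + (C k + 1) * \<kappa> k) (inf_conv f \<phi>) (x k)" for k
      unfolding C_def
    proof (rule eps_frechet_subdiff_inf_convI[OF q])
      show "0 \<le> \<epsilon> k" using decseq_ge[OF dec \<epsilon>] .
      show "- blinfun_apply (q k) v \<le> \<phi> v + \<kappa> k * norm v" for v
        using bound[of v] norm_blinfun[of "q k - p" v]
        by (simp add: \<kappa>_def blinfun.diff_left)
    qed (simp add: \<kappa>_def)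
    show "(\<lambda>k. blinfun_apply (q k) v) \<longlonglongrightarrow> blinfun_apply p v" for v
      by (intro tendsto_intros lim)
  qed
qed

end

theorem theorem5p5:
  fixes f :: "'a::banach \<Rightarrow> ereal"
    and \<phi> :: "'a \<Rightarrow> real"
    and xbar :: 'a
    and m l :: real
  assumes phi_nonneg: "\<And>x. 0 \<le> \<phi> x"
    and f_not_minf: "\<And>x. f x \<noteq> -\<infinity>"
    and f_proper: "effdom f \<noteq> {}"
    and conv_not_minf: "\<And>x. inf_conv f \<phi> x > -\<infinity>"
    and xbar: "xbar \<in> coincidence_set f \<phi>"
    and m_pos: "m > 0"
    and coercive: "\<And>x. m * norm x \<le> \<phi> x"
    and lsc: "lower_semicontinuous f"
    and l_less: "0 \<le> l" "l < m"
    and lipschitz: "l-lipschitz_on (effdom f) (\<lambda>x. real_of_ereal (f x))"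
    and subadd: "\<And>x y. \<phi> (x + y) \<le> \<phi> x + \<phi> y"
    and cont0: "isCont \<phi> 0"
    and phi0: "\<phi> 0 = 0"
  shows "limiting_subdiff (inf_conv f \<phi>) xbar
           \<subseteq> limiting_subdiff f xbar \<inter> uminus ` limiting_subdiff (\<lambda>x. ereal (\<phi> x)) 0
       \<and> ((\<forall>t>0. \<forall>x. \<phi> (t *\<^sub>R x) = t * \<phi> x) \<and>
          ((\<exists>B::'a set. finite B \<and> span B = UNIV) \<or> lower_regular f xbar)
          \<longrightarrow> limiting_subdiff (inf_conv f \<phi>) xbar
              = limiting_subdiff f xbar \<inter> uminus ` limiting_subdiff (\<lambda>x. ereal (\<phi> x)) 0)"
proof -
  interpret steep_inf_conv f \<phi> m l
    by unfold_locales (fact assms)+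
  let ?h = "inf_conv f \<phi>"
  let ?R = "limiting_subdiff f xbar \<inter> uminus ` limiting_subdiff (\<lambda>x. ereal (\<phi> x)) 0"
  \<comment> \<open>One point of finite value keeps the convolution below \<open>\<infinity>\<close> everywhere, hence \<open>f\<close> at \<open>xbar\<close> too.\<close>
  obtain d where d: "d \<in> effdom f" using f_proper by blast
  have "f xbar = ?h xbar" using xbar by (simp add: coincidence_set_def)
  also have "\<dots> \<le> f d + ereal (\<phi> (d - xbar))" by (rule inf_conv_le)
  finally have a: "xbar \<in> effdom f" using f_eq[OF d] by (auto simp: effdom_def)
  have sub: "limiting_subdiff ?h xbar \<subseteq> ?R"
  proof
    fix p assume "p \<in> limiting_subdiff ?h xbar"
    from limiting_subdiff_inf_conv_subset[OF a this] show "p \<in> ?R"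
      by (metis IntI image_eqI minus_minus)
  qed
  have "?R \<subseteq> limiting_subdiff ?h xbar"
    if hom: "\<forall>t>0. \<forall>x. \<phi> (t *\<^sub>R x) = t * \<phi> x"
      and cases: "(\<exists>B::'a set. finite B \<and> span B = UNIV) \<or> lower_regular f xbar"
  proof
    fix p assume "p \<in> ?R"
    then have p: "p \<in> limiting_subdiff f xbar"
      and "- p \<in> limiting_subdiff (\<lambda>x. ereal (\<phi> x)) 0" by auto
    then have bound: "- blinfun_apply p v \<le> \<phi> v" for v
      using linear_bound_of_limiting_subgradient_at_0[of \<phi> "- p" v] hom subadd
      by (simp add: blinfun.minus_left)
    show "p \<in> limiting_subdiff ?h xbar"
      using cases
    proof
      assume "\<exists>B::'a set. finite B \<and> span B = UNIV"
      then obtain B :: "'a set" where B: "finite B" "span B = UNIV" by blast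
      obtain \<epsilon> x q where *: "decseq \<epsilon>" "\<epsilon> \<longlonglongrightarrow> (0::real)" "x \<longlonglongrightarrow> xbar"
          "(\<lambda>k. f (x k)) \<longlonglongrightarrow> f xbar" "\<And>k::nat. q k \<in> eps_frechet_subdiff (\<epsilon> k) f (x k)"
        and "\<And>v. (\<lambda>k. blinfun_apply (q k) v) \<longlonglongrightarrow> blinfun_apply p v"
        using p unfolding limiting_subdiff_def by blast
      then have "q \<longlonglongrightarrow> p" using finite_dim_blinfun_tendsto[OF B] by blast
      from limiting_subdiff_inf_convI[OF a * this bound] show ?thesis .
    next
      assume "lower_regular f xbar"
      then have "p \<in> eps_frechet_subdiff 0 f xbar"
        using p by (simp add: lower_regular_def frechet_subdiff_def)
      then show ?thesis
        by (intro limiting_subdiff_inf_convI[OF a, of "\<lambda>_. 0" "\<lambda>_. xbar" "\<lambda>_. p"] bound)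
          (auto simp: decseq_def)
    qed
  qed
  with sub show ?thesis by blast
qed

end
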